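(* Let $N\ge 2$, $\alpha\in\{x,y,z\}$, and consider the (classical) Ising Hamiltonian $$H(t)=\sum_{i=1}^{N-1}J_i^\alpha(t)\,\sigma_i^\alpha\sigma_{i+1}^\alpha+\sum_{i=1}^{N}h_i^\alpha(t)\,\sigma_i^\alpha$$ with real coefficients. Let $\Delta t>0$, $n_t\ge1$, $t_\tau=t_0+\tau\Delta t$, and let $$U(n_t\Delta t)=\prod_{k=0}^{n_t-1}U_{n_t-k}(\Delta t),\qquad U_\tau(\Delta t)=\prod_{i=1}^{N-1}R_i^{\alpha\alpha}(2J_i^\alpha(t_\tau)\Delta t)\ \prod_{i=1}^{N}R_i^{\alpha}(2h_i^\alpha(t_\tau)\Delta t).$$ Then $U_\tau(\Delta t)=\exp(-\mathrm{i}H(t_\tau)\Delta t)$ for every $\tau$, and $U(n_t\Delta t)$ is implemented by a circuit whose depth is $O(1)$, independent of $N$ and $n_t$, consisting of one layer of single-spin rotations and two layers of two-spin rotations: $$U(n_t\Delta t)=\prod_{i\ \mathrm{odd}}R_i^{\alpha\alpha}(\phi_i)\ \prod_{i\ \mathrm{even}}R_i^{\alpha\alpha}(\phi_i)\ \prod_{i=1}^{N}R_i^\alpha(\theta_i),$$ where $\phi_i=\sum_{\tau=1}^{n_t}2J_i^\alpha(t_\tau)\Delta t$, $\theta_i=\sum_{\tau=1}^{n_t}2h_i^\alpha(t_\tau)\Delta t$, and the odd and even products run over $i\in\{1,\dots,N-1\}$. In particular the parameters of the compressed circuit can be computed with $O(n_tN)$ arithmetic operations.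
   Context: $\sigma^x,\sigma^y,\sigma^z$ are the Pauli matrices, and $\sigma_i^\alpha=I^{\otimes(i-1)}\otimes\sigma^\alpha\otimes I^{\otimes(N-i)}$ on $(\mathbb C^2)^{\otimes N}$, $I$ the $2\times2$ identity. $R_i^\alpha(\theta)=\exp(-\mathrm{i}\,\sigma_i^\alpha\,\theta/2)$ for $1\le i\le N$ and $R_i^{\alpha\alpha}(\theta)=\exp(-\mathrm{i}\,\sigma_i^\alpha\sigma_{i+1}^\alpha\,\theta/2)$ for $1\le i\le N-1$. The product $\prod_{k=0}^{n_t-1}U_{n_t-k}$ is ordered as $U_{n_t}\cdots U_2U_1$. The depth of a circuit is the number of layers, a layer being a set of gates acting on pairwise disjoint spins. *)

theory Defs
  imports Complex_Main "Jordan_Normal_Form.Matrix"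
begin

definition kron :: "complex mat \<Rightarrow> complex mat \<Rightarrow> complex mat" where
  "kron A B = mat (dim_row A * dim_row B) (dim_col A * dim_col B)
     (\<lambda>(r, c). A $$ (r div dim_row B, c div dim_col B) * B $$ (r mod dim_row B, c mod dim_col B))"

fun kron_pow :: "complex mat \<Rightarrow> nat \<Rightarrow> complex mat" where
  "kron_pow A 0 = 1\<^sub>m 1"
| "kron_pow A (Suc k) = kron A (kron_pow A k)"

text \<open>The exponential series of a square matrix, summed entry by entry; every entry
  converges absolutely.\<close>

definition mat_exp :: "complex mat \<Rightarrow> complex mat" where
  "mat_exp A = mat (dim_row A) (dim_col A) (\<lambda>(r, c). \<Sum>k. (A ^\<^sub>m k) $$ (r, c) / fact k)"

text \<open>The type of matrices of all sizes is neither a monoid nor an additive monoid, so the size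
  \<open>d\<close> of the neutral element has to be given. The first list element is the leftmost factor.\<close>

definition mat_sum :: "nat \<Rightarrow> complex mat list \<Rightarrow> complex mat" where
  "mat_sum d As = foldr (+) As (0\<^sub>m d d)"

definition mat_prod :: "nat \<Rightarrow> complex mat list \<Rightarrow> complex mat" where
  "mat_prod d As = foldr (*) As (1\<^sub>m d)"

datatype axis = AxisX | AxisY | AxisZ

fun pauli :: "axis \<Rightarrow> complex mat" where
  "pauli AxisX = mat_of_rows_list 2 [[0, 1], [1, 0]]"
| "pauli AxisY = mat_of_rows_list 2 [[0, - \<i>], [\<i>, 0]]"
| "pauli AxisZ = mat_of_rows_list 2 [[1, 0], [0, - 1]]"

text \<open>Spins are numbered from \<open>1\<close> to \<open>N\<close>; the definitions below are meaningful only for spins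
  in this range.\<close>

definition spin_op :: "nat \<Rightarrow> axis \<Rightarrow> nat \<Rightarrow> complex mat" where
  "spin_op N \<alpha> i = kron (kron (kron_pow (1\<^sub>m 2) (i - 1)) (pauli \<alpha>)) (kron_pow (1\<^sub>m 2) (N - i))"

definition rot1 :: "nat \<Rightarrow> axis \<Rightarrow> nat \<Rightarrow> real \<Rightarrow> complex mat" where
  "rot1 N \<alpha> i \<theta> = mat_exp ((- \<i> * of_real \<theta> / 2) \<cdot>\<^sub>m spin_op N \<alpha> i)"

definition rot2 :: "nat \<Rightarrow> axis \<Rightarrow> nat \<Rightarrow> real \<Rightarrow> complex mat" where
  "rot2 N \<alpha> i \<theta> = mat_exp ((- \<i> * of_real \<theta> / 2) \<cdot>\<^sub>m (spin_op N \<alpha> i * spin_op N \<alpha> (i + 1)))"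

definition ising_hamiltonian ::
  "nat \<Rightarrow> axis \<Rightarrow> (nat \<Rightarrow> real \<Rightarrow> real) \<Rightarrow> (nat \<Rightarrow> real \<Rightarrow> real) \<Rightarrow> real \<Rightarrow> complex mat" where
  "ising_hamiltonian N \<alpha> J h t =
     mat_sum (2 ^ N)
       (map (\<lambda>i. complex_of_real (J i t) \<cdot>\<^sub>m (spin_op N \<alpha> i * spin_op N \<alpha> (i + 1))) [1..<N])
     + mat_sum (2 ^ N) (map (\<lambda>i. complex_of_real (h i t) \<cdot>\<^sub>m spin_op N \<alpha> i) [1..<N + 1])"

definition time_point :: "real \<Rightarrow> real \<Rightarrow> nat \<Rightarrow> real" where
  "time_point t0 dt \<tau> = t0 + real \<tau> * dt"

definition step_op ::
  "nat \<Rightarrow> axis \<Rightarrow> (nat \<Rightarrow> real \<Rightarrow> real) \<Rightarrow> (nat \<Rightarrow> real \<Rightarrow> real) \<Rightarrow> real \<Rightarrow> real \<Rightarrow> nat \<Rightarrow> complex mat"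
where
  "step_op N \<alpha> J h t0 dt \<tau> =
     mat_prod (2 ^ N) (map (\<lambda>i. rot2 N \<alpha> i (2 * J i (time_point t0 dt \<tau>) * dt)) [1..<N])
     * mat_prod (2 ^ N) (map (\<lambda>i. rot1 N \<alpha> i (2 * h i (time_point t0 dt \<tau>) * dt)) [1..<N + 1])"

definition evolution_op ::
  "nat \<Rightarrow> axis \<Rightarrow> (nat \<Rightarrow> real \<Rightarrow> real) \<Rightarrow> (nat \<Rightarrow> real \<Rightarrow> real) \<Rightarrow> real \<Rightarrow> real \<Rightarrow> nat \<Rightarrow> complex mat"
where
  "evolution_op N \<alpha> J h t0 dt nt =
     mat_prod (2 ^ N) (map (\<lambda>k. step_op N \<alpha> J h t0 dt (nt - k)) [0..<nt])"

text \<open>Both families of compressed angles have the same form: \<open>\<phi>\<^sub>i\<close> is obtained from the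
  couplings \<open>J\<close> and \<open>\<theta>\<^sub>i\<close> from the fields \<open>h\<close>.\<close>

definition summed_angle :: "(nat \<Rightarrow> real \<Rightarrow> real) \<Rightarrow> real \<Rightarrow> real \<Rightarrow> nat \<Rightarrow> nat \<Rightarrow> real" where
  "summed_angle f t0 dt nt i = (\<Sum>\<tau> = 1..nt. 2 * f i (time_point t0 dt \<tau>) * dt)"

datatype gate = Rot1 axis nat real | Rot2 axis nat real

fun gate_op :: "nat \<Rightarrow> gate \<Rightarrow> complex mat" where
  "gate_op N (Rot1 \<alpha> i \<theta>) = rot1 N \<alpha> i \<theta>"
| "gate_op N (Rot2 \<alpha> i \<theta>) = rot2 N \<alpha> i \<theta>"

fun gate_spins :: "gate \<Rightarrow> nat set" where
  "gate_spins (Rot1 \<alpha> i \<theta>) = {i}"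
| "gate_spins (Rot2 \<alpha> i \<theta>) = {i, i + 1}"

text \<open>A layer is given by an enumeration of its gates, as the operator product of the gates needs
  some order. Gates at different positions act on disjoint spins, so no gate occurs twice.\<close>

definition is_layer :: "nat \<Rightarrow> gate list \<Rightarrow> bool" where
  "is_layer N L \<longleftrightarrow> (\<forall>g\<in>set L. gate_spins g \<subseteq> {1..N})
     \<and> sorted_wrt (\<lambda>g g'. gate_spins g \<inter> gate_spins g' = {}) L"

text \<open>The layers of a circuit are listed in the order of their application, so the operator of the
  first layer is the rightmost factor.\<close>

definition is_circuit :: "nat \<Rightarrow> gate list list \<Rightarrow> bool" where
  "is_circuit N Ls \<longleftrightarrow> (\<forall>L\<in>set Ls. is_layer N L)"

definition circuit_op :: "nat \<Rightarrow> gate list list \<Rightarrow> complex mat" where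
  "circuit_op N Ls = mat_prod (2 ^ N) (map (\<lambda>L. mat_prod (2 ^ N) (map (gate_op N) L)) (rev Ls))"

definition circuit_depth :: "gate list list \<Rightarrow> nat" where
  "circuit_depth Ls = length Ls"

definition compressed_circuit ::
  "nat \<Rightarrow> axis \<Rightarrow> (nat \<Rightarrow> real) \<Rightarrow> (nat \<Rightarrow> real) \<Rightarrow> gate list list" where
  "compressed_circuit N \<alpha> \<phi> \<theta> =
     [map (\<lambda>i. Rot1 \<alpha> i (\<theta> i)) [1..<N + 1],
      map (\<lambda>i. Rot2 \<alpha> i (\<phi> i)) (filter even [1..<N]),
      map (\<lambda>i. Rot2 \<alpha> i (\<phi> i)) (filter odd [1..<N])]"

text \<open>Arithmetic straight-line programs over named real inputs: every instruction performs one
  operation and stores its value in a new register, and the registers are numbered from \<open>0\<close> in the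
  order of the instructions. The number of operations is thus the length of the program.\<close>

datatype 'v operand = Const int | Input 'v | Reg nat

datatype 'v instr =
    Plus "'v operand" "'v operand"
  | Minus "'v operand" "'v operand"
  | Times "'v operand" "'v operand"

fun operand_val :: "('v \<Rightarrow> real) \<Rightarrow> real list \<Rightarrow> 'v operand \<Rightarrow> real" where
  "operand_val env rs (Const c) = of_int c"
| "operand_val env rs (Input v) = env v"
| "operand_val env rs (Reg k) = rs ! k"

fun instr_val :: "('v \<Rightarrow> real) \<Rightarrow> real list \<Rightarrow> 'v instr \<Rightarrow> real" where
  "instr_val env rs (Plus a b) = operand_val env rs a + operand_val env rs b"
| "instr_val env rs (Minus a b) = operand_val env rs a - operand_val env rs b"
| "instr_val env rs (Times a b) = operand_val env rs a * operand_val env rs b"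

definition run_program :: "('v \<Rightarrow> real) \<Rightarrow> 'v instr list \<Rightarrow> real list" where
  "run_program env P = foldl (\<lambda>rs ins. rs @ [instr_val env rs ins]) [] P"

fun operand_ok :: "nat \<Rightarrow> 'v operand \<Rightarrow> bool" where
  "operand_ok n (Reg k) \<longleftrightarrow> k < n"
| "operand_ok n _ \<longleftrightarrow> True"

fun instr_ok :: "nat \<Rightarrow> 'v instr \<Rightarrow> bool" where
  "instr_ok n (Plus a b) \<longleftrightarrow> operand_ok n a \<and> operand_ok n b"
| "instr_ok n (Minus a b) \<longleftrightarrow> operand_ok n a \<and> operand_ok n b"
| "instr_ok n (Times a b) \<longleftrightarrow> operand_ok n a \<and> operand_ok n b"

definition program_ok :: "'v instr list \<Rightarrow> bool" where
  "program_ok P \<longleftrightarrow> (\<forall>n < length P. instr_ok n (P ! n))"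

text \<open>\<open>CouplingAt i \<tau>\<close> and \<open>FieldAt i \<tau>\<close> name the values of \<open>J\<^sub>i\<close> and \<open>h\<^sub>i\<close> at the \<open>\<tau>\<close>-th time point.\<close>

datatype ising_input = CouplingAt nat nat | FieldAt nat nat | TimeStep

fun ising_env ::
  "(nat \<Rightarrow> real \<Rightarrow> real) \<Rightarrow> (nat \<Rightarrow> real \<Rightarrow> real) \<Rightarrow> real \<Rightarrow> real \<Rightarrow> ising_input \<Rightarrow> real" where
  "ising_env J h t0 dt (CouplingAt i \<tau>) = J i (time_point t0 dt \<tau>)"
| "ising_env J h t0 dt (FieldAt i \<tau>) = h i (time_point t0 dt \<tau>)"
| "ising_env J h t0 dt TimeStep = dt"

definition computes_angles :: "nat \<Rightarrow> nat \<Rightarrow> ising_input instr list \<Rightarrow> bool" where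
  "computes_angles N nt P \<longleftrightarrow> program_ok P \<and>
     (\<exists>out\<phi> out\<theta>.
        (\<forall>i\<in>{1..N - 1}. out\<phi> i < length P) \<and> (\<forall>i\<in>{1..N}. out\<theta> i < length P) \<and>
        (\<forall>J h t0 dt. dt > 0 \<longrightarrow>
           (\<forall>i\<in>{1..N - 1}.
              run_program (ising_env J h t0 dt) P ! out\<phi> i = summed_angle J t0 dt nt i) \<and>
           (\<forall>i\<in>{1..N}.
              run_program (ising_env J h t0 dt) P ! out\<theta> i = summed_angle h t0 dt nt i)))"

end

theory Submission
  imports Defs
begin

text \<open>All gates are diagonal in one basis, the \<open>N\<close>-fold tensor power of an eigenbasis of the Pauli
  matrix \<open>\<sigma>\<^sup>\<alpha>\<close>. In this basis each rotation, each time step and the full evolution is the exponential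
  of a diagonal matrix that depends linearly on the angles, so all operator identities reduce to
  identities between finite sums of angles.\<close>

section \<open>Kronecker products\<close>

lemma dim_kron [simp]:
  "dim_row (kron A B) = dim_row A * dim_row B" "dim_col (kron A B) = dim_col A * dim_col B"
  by (simp_all add: kron_def)

lemma kron_carrier [simp]:
  "A \<in> carrier_mat a b \<Longrightarrow> B \<in> carrier_mat c d \<Longrightarrow> kron A B \<in> carrier_mat (a * c) (b * d)"
  by (intro carrier_matI) (simp_all only: dim_kron carrier_matD)

lemma index_kron:
  "r < dim_row A * dim_row B \<Longrightarrow> c < dim_col A * dim_col B \<Longrightarrow>
   kron A B $$ (r, c) = A $$ (r div dim_row B, c div dim_col B) * B $$ (r mod dim_row B, c mod dim_col B)"
  by (simp add: kron_def)

lemma mod_less_of_less_mult: "r < a * b \<Longrightarrow> r mod b < b" for r a b :: nat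
  by (cases "b = 0") auto

lemma mod_mult_div_mod:
  fixes r b c :: nat
  assumes "c > 0"
  shows "r mod (b * c) div c = r div c mod b" "r mod (b * c) mod c = r mod c"
  using assms by (simp_all add: mult.commute[of b c] mod_mult2_eq)

text \<open>Both groupings read an index in the same mixed-radix expansion and differ only in the
  order in which the digits are split off.\<close>

lemma kron_assoc: "kron (kron A B) C = kron A (kron B C)"
proof (rule eq_matI)
  fix r c
  assume "r < dim_row (kron A (kron B C))" "c < dim_col (kron A (kron B C))"
  then have r: "r < dim_row A * dim_row B * dim_row C" and c: "c < dim_col A * dim_col B * dim_col C"
    by (simp_all add: mult.assoc)
  \<comment> \<open>The existence of an index \<open>r\<close> or \<open>c\<close> in range rules
    out empty factors, so all divisors below are positive.\<close>
  have pos: "dim_row C > 0" "dim_col C > 0" "dim_row B * dim_row C > 0" "dim_col B * dim_col C > 0"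
    using r c by (auto intro!: gr0I)
  have r1: "r div dim_row C < dim_row A * dim_row B" and c1: "c div dim_col C < dim_col A * dim_col B"
    using r c by (simp_all add: less_mult_imp_div_less)
  have r2: "r mod (dim_row B * dim_row C) < dim_row B * dim_row C"
    and c2: "c mod (dim_col B * dim_col C) < dim_col B * dim_col C"
    using pos by simp_all
  have dr: "r div (dim_row B * dim_row C) = r div dim_row C div dim_row B"
    by (subst mult.commute) (simp add: div_mult2_eq)
  have dc: "c div (dim_col B * dim_col C) = c div dim_col C div dim_col B"
    by (subst mult.commute) (simp add: div_mult2_eq)
  show "kron (kron A B) C $$ (r, c) = kron A (kron B C) $$ (r, c)"
    using r c r1 c1 r2 c2 pos dr dc
    by (simp add: index_kron mod_mult_div_mod mult.assoc)
qed (simp_all add: mult.assoc)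

text \<open>Division with remainder is a bijection onto pairs. This splits the inner index of a
  product of two Kronecker products.\<close>

lemma sum_div_mod:
  fixes f :: "nat \<Rightarrow> nat \<Rightarrow> 'a::comm_monoid_add"
  shows "(\<Sum>k = 0..<m * n. f (k div n) (k mod n)) = (\<Sum>i = 0..<m. \<Sum>j = 0..<n. f i j)"
proof -
  have "(\<Sum>i = 0..<m. \<Sum>j = 0..<n. f i j) = (\<Sum>(i, j)\<in>{0..<m} \<times> {0..<n}. f i j)"
    by (simp add: sum.cartesian_product)
  also have "\<dots> = (\<Sum>k = 0..<m * n. f (k div n) (k mod n))"
  proof (rule sum.reindex_bij_witness[where j = "\<lambda>(i, j). i * n + j" and i = "\<lambda>k. (k div n, k mod n)"])
    fix p assume p: "p \<in> {0..<m} \<times> {0..<n}"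
    obtain i j where ij: "p = (i, j)" "i < m" "j < n" using p by auto
    have "i * n + j < Suc i * n" using ij by simp
    also have "\<dots> \<le> m * n" using ij by (intro mult_le_mono1) simp
    finally show "(case p of (i, j) \<Rightarrow> i * n + j) \<in> {0..<m * n}" using ij by simp
  qed (auto simp: less_mult_imp_div_less mod_less_of_less_mult)
  finally show ?thesis by simp
qed

text \<open>The mixed-product rule: once the summation index is split into quotient and remainder,
  the double sum factors into one sum for each tensor factor.\<close>

lemma kron_mult_kron:
  assumes "dim_col A = dim_row C" "dim_col B = dim_row D"
  shows "kron A B * kron C D = kron (A * C) (B * D)"
proof (rule eq_matI)
  fix r c
  assume "r < dim_row (kron (A * C) (B * D))" "c < dim_col (kron (A * C) (B * D))"
  then have r: "r < dim_row A * dim_row B" and c: "c < dim_col C * dim_col D"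
    by simp_all
  note r' = less_mult_imp_div_less[OF r] mod_less_of_less_mult[OF r]
  note c' = less_mult_imp_div_less[OF c] mod_less_of_less_mult[OF c]
  let ?f = "\<lambda>i j. A $$ (r div dim_row B, i) * B $$ (r mod dim_row B, j)
      * (C $$ (i, c div dim_col D) * D $$ (j, c mod dim_col D))"
  have "(kron A B * kron C D) $$ (r, c)
      = (\<Sum>k = 0..<dim_row C * dim_row D. ?f (k div dim_row D) (k mod dim_row D))"
    using r c assms by (simp add: scalar_prod_def index_kron)
  also have "\<dots> = (\<Sum>i = 0..<dim_row C. \<Sum>j = 0..<dim_row D. ?f i j)"
    by (rule sum_div_mod)
  also have "\<dots> = kron (A * C) (B * D) $$ (r, c)"
    using r c r' c' assms
    by (simp add: index_kron scalar_prod_def sum_product algebra_simps)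
  finally show "(kron A B * kron C D) $$ (r, c) = kron (A * C) (B * D) $$ (r, c)" .
qed simp_all

lemma kron_mat_diag:
  "kron (mat_diag m f) (mat_diag n g) = mat_diag (m * n) (\<lambda>r. f (r div n) * g (r mod n))"
proof (rule eq_matI)
  fix r c
  assume "r < dim_row (mat_diag (m * n) (\<lambda>r. f (r div n) * g (r mod n)))"
    "c < dim_col (mat_diag (m * n) (\<lambda>r. f (r div n) * g (r mod n)))"
  then have r: "r < m * n" and c: "c < m * n" by (simp_all add: mat_diag_def)
  have "r = c" if "r div n = c div n" "r mod n = c mod n"
    using that by (metis div_mult_mod_eq)
  then show "kron (mat_diag m f) (mat_diag n g) $$ (r, c)
      = mat_diag (m * n) (\<lambda>r. f (r div n) * g (r mod n)) $$ (r, c)"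
    using r c by (auto simp: index_kron mat_diag_def less_mult_imp_div_less mod_less_of_less_mult)
qed (simp_all add: mat_diag_def)

lemma kron_one: "kron (1\<^sub>m m) (1\<^sub>m n) = 1\<^sub>m (m * n)"
  using kron_mat_diag[of m "\<lambda>_. 1" n "\<lambda>_. 1"] by simp

lemma kron_one_left: "kron (1\<^sub>m 1) A = A"
  by (rule eq_matI) (simp_all add: index_kron)

lemma kron_pow_carrier: "A \<in> carrier_mat a b \<Longrightarrow> kron_pow A k \<in> carrier_mat (a ^ k) (b ^ k)"
  by (induction k) auto

lemma kron_pow_one: "kron_pow (1\<^sub>m a) k = 1\<^sub>m (a ^ k)"
  by (induction k) (simp_all add: kron_one)

lemma kron_pow_add: "kron_pow A (m + n) = kron (kron_pow A m) (kron_pow A n)"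
  by (induction m) (simp_all add: kron_one_left[simplified] kron_assoc)

lemma kron_pow_mult:
  assumes "A \<in> carrier_mat a b" "B \<in> carrier_mat b c"
  shows "kron_pow A k * kron_pow B k = kron_pow (A * B) k"
proof (induction k)
  case (Suc k)
  show ?case
    using assms kron_pow_carrier[OF assms(1), of k] kron_pow_carrier[OF assms(2), of k] Suc
    by (simp add: kron_mult_kron)
qed simp

section \<open>Simultaneously diagonalizable matrices\<close>

locale diagonalizer =
  fixes d :: nat and S T :: "complex mat"
  assumes S_carrier [simp]: "S \<in> carrier_mat d d"
    and T_carrier [simp]: "T \<in> carrier_mat d d"
    and S_T: "S * T = 1\<^sub>m d"
    and T_S: "T * S = 1\<^sub>m d"
begin

text \<open>For fixed \<open>S\<close> and \<open>T\<close> this is an algebra homomorphism from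
  functions under pointwise operations to matrices. Matrix identities thereby become pointwise
  identities of eigenvalue functions.\<close>

definition diag_op :: "(nat \<Rightarrow> complex) \<Rightarrow> complex mat" where
  "diag_op f = S * mat_diag d f * T"

lemma diag_op_carrier [simp]: "diag_op f \<in> carrier_mat d d"
  unfolding diag_op_def
  by (rule mult_carrier_mat[OF mult_carrier_mat[OF S_carrier mat_diag_dim] T_carrier])

lemma dim_diag_op [simp]: "dim_row (diag_op f) = d" "dim_col (diag_op f) = d"
  using carrier_matD[OF diag_op_carrier] by simp_all

text \<open>Each entry is a finite linear combination of the values of \<open>f\<close> with
  coefficients independent of \<open>f\<close>; linearity and the exponential series can therefore
  be handled entrywise.\<close>

lemma index_diag_op:
  assumes "r < d" "c < d"
  shows "diag_op f $$ (r, c) = (\<Sum>a = 0..<d. S $$ (r, a) * T $$ (a, c) * f a)"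
proof -
  have dims: "dim_row S = d" "dim_col S = d" "dim_row T = d" "dim_col T = d"
    using carrier_matD[OF S_carrier] carrier_matD[OF T_carrier] by simp_all
  show ?thesis
    unfolding diag_op_def mat_diag_mult_right[OF S_carrier]
    using assms dims by (simp add: scalar_prod_def mult_ac)
qed

lemma diag_op_mult: "diag_op f * diag_op g = diag_op (\<lambda>x. f x * g x)"
proof -
  note cS = mult_carrier_mat[OF S_carrier mat_diag_dim]
    and cT = mult_carrier_mat[OF mat_diag_dim T_carrier]
  have "diag_op f * diag_op g = S * mat_diag d f * (T * (S * mat_diag d g * T))"
    unfolding diag_op_def by (rule assoc_mult_mat[OF cS T_carrier mult_carrier_mat[OF cS T_carrier]])
  also have "T * (S * mat_diag d g * T) = T * S * (mat_diag d g * T)"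
    unfolding assoc_mult_mat[OF S_carrier mat_diag_dim T_carrier]
    by (rule assoc_mult_mat[symmetric, OF T_carrier S_carrier cT])
  also have "\<dots> = mat_diag d g * T"
    unfolding T_S by (rule left_mult_one_mat[OF cT])
  also have "S * mat_diag d f * (mat_diag d g * T) = S * mat_diag d f * mat_diag d g * T"
    by (rule assoc_mult_mat[symmetric, OF cS mat_diag_dim T_carrier])
  also have "S * mat_diag d f * mat_diag d g = S * mat_diag d (\<lambda>x. f x * g x)"
    unfolding assoc_mult_mat[OF S_carrier mat_diag_dim mat_diag_dim] mat_diag_diag ..
  finally show ?thesis by (simp only: diag_op_def)
qed

lemma diag_op_add: "diag_op f + diag_op g = diag_op (\<lambda>x. f x + g x)"
  by (rule eq_matI) (simp_all add: index_diag_op sum.distrib algebra_simps)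

lemma diag_op_smult: "k \<cdot>\<^sub>m diag_op f = diag_op (\<lambda>x. k * f x)"
  by (rule eq_matI) (simp_all add: index_diag_op sum_distrib_left mult_ac)

lemma diag_op_one: "diag_op (\<lambda>x. 1) = 1\<^sub>m d"
  unfolding diag_op_def mat_diag_one right_mult_one_mat[OF S_carrier] by (rule S_T)

lemma diag_op_zero: "diag_op (\<lambda>x. 0) = 0\<^sub>m d d"
  by (rule eq_matI) (simp_all add: index_diag_op)

lemma diag_op_pow: "diag_op f ^\<^sub>m k = diag_op (\<lambda>x. f x ^ k)"
  by (induction k) (simp_all add: diag_op_one diag_op_mult mult_ac)

text \<open>Powers act on the eigenvalues only, so each entry of the series is a finite combination
  of scalar exponential series, which may be summed separately.\<close>

lemma mat_exp_diag_op: "mat_exp (diag_op f) = diag_op (\<lambda>x. exp (f x))"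
proof (rule eq_matI)
  fix r c
  assume "r < dim_row (diag_op (\<lambda>x. exp (f x)))" "c < dim_col (diag_op (\<lambda>x. exp (f x)))"
  then have rc: "r < d" "c < d" by simp_all
  have s: "(\<lambda>k. S $$ (r, a) * T $$ (a, c) * (f a ^ k / fact k)) sums
      (S $$ (r, a) * T $$ (a, c) * exp (f a))" for a
    using exp_converges[of "f a"]
    by (intro sums_mult) (simp add: scaleR_conv_of_real field_simps)
  have "(\<lambda>k. \<Sum>a = 0..<d. S $$ (r, a) * T $$ (a, c) * (f a ^ k / fact k)) sums
      (\<Sum>a = 0..<d. S $$ (r, a) * T $$ (a, c) * exp (f a))"
    by (intro sums_sum s)
  then have "(\<lambda>k. (diag_op f ^\<^sub>m k) $$ (r, c) / fact k) sums (diag_op (\<lambda>x. exp (f x)) $$ (r, c))"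
    using rc by (simp add: diag_op_pow index_diag_op sum_divide_distrib)
  then show "mat_exp (diag_op f) $$ (r, c) = diag_op (\<lambda>x. exp (f x)) $$ (r, c)"
    using rc by (simp add: mat_exp_def sums_iff)
qed (simp_all add: mat_exp_def)

lemma mat_sum_diag_op:
  "mat_sum d (map (\<lambda>i. diag_op (f i)) xs) = diag_op (\<lambda>x. \<Sum>i\<leftarrow>xs. f i x)"
  by (induction xs) (simp_all add: mat_sum_def diag_op_zero diag_op_add)

lemma mat_prod_exp_diag_op:
  "mat_prod d (map (\<lambda>i. diag_op (\<lambda>x. exp (f i x))) xs) = diag_op (\<lambda>x. exp (\<Sum>i\<leftarrow>xs. f i x))"
  by (induction xs) (simp_all add: mat_prod_def diag_op_one diag_op_mult exp_add)

end

section \<open>A common eigenbasis of the spin operators\<close>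

text \<open>The columns are eigenvectors for 1 and -1, in this order for every axis, so one
  eigenvalue function serves all three. They are left unnormalized for x and y, which avoids square
  roots and puts factors 1/2 into the inverse.\<close>

fun pauli_basis :: "axis \<Rightarrow> complex mat" where
  "pauli_basis AxisX = mat_of_rows_list 2 [[1, 1], [1, - 1]]"
| "pauli_basis AxisY = mat_of_rows_list 2 [[1, 1], [\<i>, - \<i>]]"
| "pauli_basis AxisZ = 1\<^sub>m 2"

fun pauli_basis_inv :: "axis \<Rightarrow> complex mat" where
  "pauli_basis_inv AxisX = mat_of_rows_list 2 [[1 / 2, 1 / 2], [1 / 2, - 1 / 2]]"
| "pauli_basis_inv AxisY = mat_of_rows_list 2 [[1 / 2, - \<i> / 2], [1 / 2, \<i> / 2]]"
| "pauli_basis_inv AxisZ = 1\<^sub>m 2"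

definition pauli_eigenvalue :: "nat \<Rightarrow> complex" where
  "pauli_eigenvalue k = (if k = 0 then 1 else - 1)"

lemma pauli_basis_carrier:
  "pauli_basis \<alpha> \<in> carrier_mat 2 2" "pauli_basis_inv \<alpha> \<in> carrier_mat 2 2"
  "pauli \<alpha> \<in> carrier_mat 2 2"
  by (cases \<alpha>; intro carrier_matI; simp add: mat_of_rows_list_def)+

lemma mat_2_mult:
  fixes a b c d :: "'a :: comm_ring_1"
  shows "mat_of_rows_list 2 [[a, b], [c, d]] * mat_of_rows_list 2 [[a', b'], [c', d']]
    = mat_of_rows_list 2 [[a * a' + b * c', a * b' + b * d'], [c * a' + d * c', c * b' + d * d']]"
  by (rule eq_matI)
    (auto simp: mat_of_rows_list_def scalar_prod_def less_Suc_eq numeral_2_eq_2)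

lemma mat_diag_2: "mat_diag 2 f = mat_of_rows_list 2 [[f 0, 0], [0, f 1]]"
  by (rule eq_matI) (auto simp: mat_of_rows_list_def mat_diag_def less_Suc_eq numeral_2_eq_2)

lemma one_mat_2: "1\<^sub>m 2 = mat_of_rows_list 2 [[1, 0], [0, 1]]"
  using mat_diag_2[of "\<lambda>_. 1"] by (simp only: mat_diag_one)

lemma pauli_basis_inverse:
  "pauli_basis \<alpha> * pauli_basis_inv \<alpha> = 1\<^sub>m 2" "pauli_basis_inv \<alpha> * pauli_basis \<alpha> = 1\<^sub>m 2"
  by (cases \<alpha>; simp add: mat_2_mult one_mat_2)+

lemma pauli_diagonalization:
  "pauli \<alpha> = pauli_basis \<alpha> * mat_diag 2 pauli_eigenvalue * pauli_basis_inv \<alpha>"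
  by (cases \<alpha>) (simp_all add: mat_2_mult one_mat_2 mat_diag_2 pauli_eigenvalue_def)

lemma diagonalizer_kron_pow:
  "diagonalizer (2 ^ N) (kron_pow (pauli_basis \<alpha>) N) (kron_pow (pauli_basis_inv \<alpha>) N)"
proof
  note c = pauli_basis_carrier[of \<alpha>]
  show "kron_pow (pauli_basis \<alpha>) N \<in> carrier_mat (2 ^ N) (2 ^ N)"
    "kron_pow (pauli_basis_inv \<alpha>) N \<in> carrier_mat (2 ^ N) (2 ^ N)"
    using c by (auto intro: kron_pow_carrier)
  show "kron_pow (pauli_basis \<alpha>) N * kron_pow (pauli_basis_inv \<alpha>) N = 1\<^sub>m (2 ^ N)"
    "kron_pow (pauli_basis_inv \<alpha>) N * kron_pow (pauli_basis \<alpha>) N = 1\<^sub>m (2 ^ N)"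
    using c by (simp_all add: kron_pow_mult[of _ 2 2 _ 2] pauli_basis_inverse kron_pow_one)
qed

lemma kron_pow_split:
  assumes "i \<in> {1..N}"
  shows "kron_pow A N = kron (kron (kron_pow A (i - 1)) A) (kron_pow A (N - i))"
proof -
  have "N = (i - 1) + Suc (N - i)" using assms by simp
  then have "kron_pow A N = kron (kron_pow A (i - 1)) (kron_pow A (Suc (N - i)))"
    using kron_pow_add by metis
  then show ?thesis by (simp add: kron_assoc)
qed

text \<open>Cut at spin \<open>i\<close>, the conjugation acts on three tensor factors separately:
  the outer two cancel to identities and the middle one gives the Pauli matrix. The basis change
  does not depend on \<open>i\<close>, which makes the diagonalization simultaneous.\<close>

lemma spin_op_diagonalization:
  assumes i: "i \<in> {1..N}"
  obtains f where "spin_op N \<alpha> i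
    = kron_pow (pauli_basis \<alpha>) N * mat_diag (2 ^ N) f * kron_pow (pauli_basis_inv \<alpha>) N"
proof -
  let ?V = "pauli_basis \<alpha>" and ?W = "pauli_basis_inv \<alpha>" and ?m = "i - 1" and ?n = "N - i"
  note c = pauli_basis_carrier[of \<alpha>]
  note cV = kron_pow_carrier[OF c(1)] and cW = kron_pow_carrier[OF c(2)]
  have N: "2 ^ ?m * 2 * 2 ^ ?n = (2 ^ N :: nat)"
    using i by (simp flip: power_add power_Suc2)
  let ?D = "kron (kron (1\<^sub>m (2 ^ ?m)) (mat_diag 2 pauli_eigenvalue)) (1\<^sub>m (2 ^ ?n))"
  \<comment> \<open>Spin 1 is the most significant binary digit of the basis index \<open>r\<close>,
    so the state of spin \<open>i\<close> is the digit of weight \<open>2 ^ (N - i)\<close>.\<close>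
  have D: "?D = mat_diag (2 ^ N) (\<lambda>r. pauli_eigenvalue (r div 2 ^ ?n mod 2))"
    using kron_mat_diag[of "2 ^ ?m" "\<lambda>_. 1" 2 pauli_eigenvalue]
      kron_mat_diag[of "2 ^ ?m * 2" "\<lambda>r. pauli_eigenvalue (r mod 2)" "2 ^ ?n" "\<lambda>_. 1"]
    by (simp add: N[simplified])
  \<comment> \<open>The result stays a tensor power of the identity, the form of the padding in
    \<open>spin_op\<close>.\<close>
  have id: "kron_pow ?V k * 1\<^sub>m (2 ^ k) * kron_pow ?W k = kron_pow (1\<^sub>m 2) k" for k
    using c cV[of k] right_mult_one_mat[OF cV[of k]]
    by (simp add: kron_pow_mult[of _ 2 2 _ 2] pauli_basis_inverse)
  have dims: "dim_row ?V = 2" "dim_col ?V = 2" "dim_row ?W = 2" "dim_col ?W = 2"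
    "dim_row (kron_pow ?V k) = 2 ^ k" "dim_col (kron_pow ?V k) = 2 ^ k"
    "dim_row (kron_pow ?W k) = 2 ^ k" "dim_col (kron_pow ?W k) = 2 ^ k" for k
    using c cV[of k] cW[of k] by auto
  have "kron_pow ?V N * ?D * kron_pow ?W N
      = kron (kron (kron_pow ?V ?m * 1\<^sub>m (2 ^ ?m) * kron_pow ?W ?m)
            (?V * mat_diag 2 pauli_eigenvalue * ?W))
          (kron_pow ?V ?n * 1\<^sub>m (2 ^ ?n) * kron_pow ?W ?n)"
    unfolding kron_pow_split[OF i, of ?V] kron_pow_split[OF i, of ?W]
    by (simp only: kron_mult_kron dims dim_kron index_mult_mat index_one_mat mat_diag_def dim_row_mat dim_col_mat)
  also have "\<dots> = spin_op N \<alpha> i"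
    by (simp only: id spin_op_def flip: pauli_diagonalization)
  finally have "spin_op N \<alpha> i = kron_pow ?V N
      * mat_diag (2 ^ N) (\<lambda>r. pauli_eigenvalue (r div 2 ^ ?n mod 2)) * kron_pow ?W N"
    by (simp only: D)
  then show ?thesis by (rule that)
qed

section \<open>Evaluation of straight-line programs\<close>

lemma run_program_snoc:
  "run_program env (P @ [ins]) = run_program env P @ [instr_val env (run_program env P) ins]"
  by (simp add: run_program_def)

lemma length_run_program [simp]: "length (run_program env P) = length P"
  by (induction P rule: rev_induct) (simp_all add: run_program_snoc run_program_def[of _ "[]"])

lemma operand_val_append:
  "operand_ok (length rs) a \<Longrightarrow> operand_val env (rs @ rs') a = operand_val env rs a"
  by (cases a) (simp_all add: nth_append)

lemma instr_val_append:
  "instr_ok (length rs) ins \<Longrightarrow> instr_val env (rs @ rs') ins = instr_val env rs ins"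
  by (cases ins) (simp_all add: operand_val_append)

lemma operand_ok_mono: "operand_ok m a \<Longrightarrow> m \<le> n \<Longrightarrow> operand_ok n a"
  by (cases a) simp_all

text \<open>Instructions read earlier registers only, and later registers are merely appended. A run
  thus satisfies one equation per register in terms of the final register list, and programs can be
  analysed without unfolding the execution.\<close>

lemma run_program_nth:
  assumes "program_ok P" "n < length P"
  shows "run_program env P ! n = instr_val env (run_program env P) (P ! n)"
  using assms
proof (induction P rule: rev_induct)
  case (snoc ins P)
  have ok: "instr_ok k ((P @ [ins]) ! k)" if "k < Suc (length P)" for k
    using snoc.prems(1) that by (simp add: program_ok_def)
  have P: "program_ok P"
    unfolding program_ok_def using ok by (metis less_Suc_eq nth_append)
  show ?case
  proof (cases "n < length P")
    case True
    then have "instr_ok n (P ! n)" using P by (simp add: program_ok_def)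
    have "instr_ok (length (run_program env P)) (P ! n)"
      using \<open>instr_ok n (P ! n)\<close> True by (cases "P ! n") (auto intro: operand_ok_mono)
    then show ?thesis
      using True snoc.IH[OF P True] by (simp add: run_program_snoc nth_append instr_val_append)
  next
    case False
    then have "n = length P" using snoc.prems(2) by simp
    then show ?thesis
      using ok[of "length P"] by (simp add: run_program_snoc nth_append instr_val_append)
  qed
qed simp

section \<open>Programs for the angles\<close>

text \<open>Here \<open>n\<close> is the absolute register number and \<open>r\<close> the position
  within a block. The preceding register serves as accumulator, \<open>v r\<close> is the input
  added at position \<open>r\<close>, and the last case is meant for
  \<open>r = nt + 2\<close>.\<close>

fun angle_instr :: "nat \<Rightarrow> (nat \<Rightarrow> ising_input) \<Rightarrow> nat \<Rightarrow> nat \<Rightarrow> ising_input instr" where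
  "angle_instr nt v n r =
     (if r = 0 then Plus (Const 0) (Const 0)
      else if r \<le> nt then Plus (Reg (n - 1)) (Input (v r))
      else if r = nt + 1 then Plus (Reg (n - 1)) (Reg (n - 1))
      else Times (Reg (n - 1)) (Input TimeStep))"

text \<open>The \<open>2N - 1\<close> angles are computed in consecutive blocks of \<open>nt + 3\<close> instructions: a zero,
  \<open>nt\<close> additions, a doubling and the product with the time step. The first \<open>N - 1\<close> blocks belong
  to the couplings; hence block \<open>j \<ge> N - 1\<close> belongs to the field at spin \<open>j - (N - 1) + 1\<close>.\<close>

definition angle_input :: "nat \<Rightarrow> nat \<Rightarrow> nat \<Rightarrow> ising_input" where
  "angle_input N j \<tau> = (if j < N - 1 then CouplingAt (j + 1) \<tau> else FieldAt (j + 2 - N) \<tau>)"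

definition angle_program :: "nat \<Rightarrow> nat \<Rightarrow> ising_input instr list" where
  "angle_program N nt =
     map (\<lambda>n. angle_instr nt (angle_input N (n div (nt + 3))) n (n mod (nt + 3)))
       [0..<(2 * N - 1) * (nt + 3)]"

lemma length_angle_program: "length (angle_program N nt) = (2 * N - 1) * (nt + 3)"
  by (simp add: angle_program_def)

lemma angle_program_ok: "program_ok (angle_program N nt)"
proof -
  \<comment> \<open>With truncated subtraction this fails at \<open>n = 0\<close> only, where a
    block starts and just constants are read.\<close>
  have "n - 1 < n" if "n mod (nt + 3) \<noteq> 0" for n
    using that by (cases n) auto
  then show ?thesis
    by (simp add: program_ok_def angle_program_def)
qed

lemma angle_index_less:
  fixes j r :: nat
  assumes "j < K" "r < L"
  shows "j * L + r < K * L"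
proof -
  have "j * L + r < Suc j * L" using assms by simp
  also have "\<dots> \<le> K * L" using assms by (intro mult_le_mono1) simp
  finally show ?thesis .
qed

text \<open>The offset \<open>nt + 2\<close> is the last position of block \<open>j\<close>, reached
  after the additions, the doubling and the multiplication by the time step.\<close>

lemma run_angle_program:
  fixes nt :: nat
  defines "L \<equiv> nt + 3"
  assumes j: "j < 2 * N - 1"
  shows "run_program env (angle_program N nt) ! (j * L + (nt + 2))
    = (\<Sum>\<tau> = 1..nt. env (angle_input N j \<tau>)) * 2 * env TimeStep"
proof -
  let ?R = "run_program env (angle_program N nt)"
  have step: "?R ! (j * L + r) = instr_val env ?R (angle_instr nt (angle_input N j) (j * L + r) r)"
    if "r < L" for r
  proof -
    have n: "j * L + r < (2 * N - 1) * L" by (rule angle_index_less[OF j that])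
    have "(j * L + r) div L = j" "(j * L + r) mod L = r" using that by simp_all
    then have "angle_program N nt ! (j * L + r) = angle_instr nt (angle_input N j) (j * L + r) r"
      using n unfolding angle_program_def L_def by simp
    then show ?thesis
      using run_program_nth[OF angle_program_ok, of "j * L + r" N nt env] n
      by (simp add: length_angle_program L_def)
  qed
  \<comment> \<open>Loop invariant of a block: after \<open>r\<close> additions the accumulator
    holds the first \<open>r\<close> samples.\<close>
  have partial: "?R ! (j * L + r) = (\<Sum>\<tau> = 1..r. env (angle_input N j \<tau>))" if "r \<le> nt" for r
    using that
  proof (induction r)
    case 0
    then show ?case using step[of 0] by (simp add: L_def)
  next
    case (Suc r)
    then show ?case using step[of "Suc r"] by (simp add: L_def)
  qed
  have "?R ! (j * L + Suc nt) = 2 * (\<Sum>\<tau> = 1..nt. env (angle_input N j \<tau>))"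
    using step[of "Suc nt"] partial[of nt] by (simp add: L_def)
  then show ?thesis
    using step[of "Suc (Suc nt)"] by (simp add: L_def)
qed

lemma angle_program_computes_angles: "computes_angles N nt (angle_program N nt)"
proof -
  let ?L = "nt + 3" and ?P = "angle_program N nt"
  \<comment> \<open>These are the last registers of the blocks \<open>i - 1\<close> for couplings
    and \<open>(N - 1) + (i - 1)\<close> for fields.\<close>
  let ?out\<phi> = "\<lambda>i. (i - 1) * ?L + (nt + 2)" and ?out\<theta> = "\<lambda>i. (N + i - 2) * ?L + (nt + 2)"
  have len: "j * ?L + (nt + 2) < length ?P" if "j < 2 * N - 1" for j
    using angle_index_less[OF that, of "nt + 2" ?L] by (simp add: length_angle_program)
  have out\<phi>: "?out\<phi> i < length ?P" if "i \<in> {1..N - 1}" for i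
    using that by (intro len) auto
  have out\<theta>: "?out\<theta> i < length ?P" if "i \<in> {1..N}" for i
    using that by (intro len) auto
  have val\<phi>: "run_program (ising_env J h t0 dt) ?P ! ?out\<phi> i = summed_angle J t0 dt nt i"
    if "i \<in> {1..N - 1}" for J h t0 dt i
  proof -
    have "angle_input N (i - 1) = CouplingAt i"
      using that by (auto simp: angle_input_def)
    moreover have "i - 1 < 2 * N - 1" using that by auto
    ultimately show ?thesis
      by (simp only: run_angle_program)
        (simp add: summed_angle_def sum_distrib_left sum_distrib_right mult_ac)
  qed
  have val\<theta>: "run_program (ising_env J h t0 dt) ?P ! ?out\<theta> i = summed_angle h t0 dt nt i"
    if "i \<in> {1..N}" for J h t0 dt i
  proof -
    have "angle_input N (N + i - 2) = FieldAt i"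
      using that by (intro ext) (auto simp: angle_input_def)
    moreover have "N + i - 2 < 2 * N - 1" using that by auto
    ultimately show ?thesis
      by (simp only: run_angle_program)
        (simp add: summed_angle_def sum_distrib_left sum_distrib_right mult_ac)
  qed
  show ?thesis
    unfolding computes_angles_def
    by (intro conjI exI[of _ ?out\<phi>] exI[of _ ?out\<theta>] allI impI ballI
        angle_program_ok out\<phi> out\<theta> val\<phi> val\<theta>)
qed

lemma length_angle_program_le:
  assumes "nt \<ge> 1"
  shows "length (angle_program N nt) \<le> 8 * (nt * N)"
proof -
  \<comment> \<open>From \<open>nt \<ge> 1\<close> follows \<open>nt + 3 \<le> 4 * nt\<close>;
    together with the factor 2 this gives the constant 8.\<close>
  have "(2 * N - 1) * (nt + 3) \<le> (2 * N) * (4 * nt)"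
    using assms by (intro mult_le_mono) auto
  then show ?thesis by (simp add: length_angle_program mult_ac)
qed

section \<open>The compressed circuit\<close>

lemma sum_list_filter_odd_even:
  "(\<Sum>i\<leftarrow>filter odd xs. f i) + (\<Sum>i\<leftarrow>filter even xs. f i) = (\<Sum>i\<leftarrow>xs. f i)"
  for f :: "nat \<Rightarrow> 'a::comm_monoid_add"
  by (induction xs) (simp_all add: ac_simps)

lemma is_circuit_compressed: "is_circuit N (compressed_circuit N \<alpha> \<phi> \<theta>)"
proof -
  have two: "is_layer N (map (\<lambda>i. Rot2 \<alpha> i (\<phi> i)) (filter P [1..<N]))"
    if P: "P = even \<or> P = odd" for P :: "nat \<Rightarrow> bool"
  proof -
    have "sorted_wrt (<) (filter P [1..<N])"
      by (simp add: sorted_wrt_filter)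
    \<comment> \<open>Distinct bonds of equal parity start at least two sites apart, so they share
      no spin.\<close>
    then have "sorted_wrt (\<lambda>i j. {i, i + 1} \<inter> {j, j + 1} = {}) (filter P [1..<N])"
      by (rule sorted_wrt_mono_rel[rotated]) (use P in auto)
    then show ?thesis
      by (auto simp: is_layer_def sorted_wrt_map simp del: insert_disjoint disjoint_insert)
  qed
  have "sorted_wrt (\<lambda>i j. {i} \<inter> {j} = {}) [1..<N + 1]"
    by (rule sorted_wrt_mono_rel[OF _ sorted_wrt_upt]) auto
  then have "is_layer N (map (\<lambda>i. Rot1 \<alpha> i (\<theta> i)) [1..<N + 1])"
    by (auto simp: is_layer_def sorted_wrt_map simp del: upt_Suc insert_disjoint disjoint_insert)
  then show ?thesis
    using two[of even] two[of odd] by (simp add: is_circuit_def compressed_circuit_def del: upt_Suc)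
qed

lemma compressed_evolution:
  fixes N nt :: nat and \<alpha> :: axis and J h :: "nat \<Rightarrow> real \<Rightarrow> real" and t0 dt :: real
  defines "\<phi> \<equiv> summed_angle J t0 dt nt" and "\<theta> \<equiv> summed_angle h t0 dt nt"
    and "t \<equiv> time_point t0 dt"
  shows "step_op N \<alpha> J h t0 dt \<tau>
      = mat_exp ((- \<i> * complex_of_real dt) \<cdot>\<^sub>m ising_hamiltonian N \<alpha> J h (t \<tau>))" (is ?step)
    and "evolution_op N \<alpha> J h t0 dt nt
      = mat_prod (2 ^ N) (map (\<lambda>i. rot2 N \<alpha> i (\<phi> i)) (filter odd [1..<N]))
        * mat_prod (2 ^ N) (map (\<lambda>i. rot2 N \<alpha> i (\<phi> i)) (filter even [1..<N]))
        * mat_prod (2 ^ N) (map (\<lambda>i. rot1 N \<alpha> i (\<theta> i)) [1..<N + 1])" (is ?compressed)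
    and "circuit_op N (compressed_circuit N \<alpha> \<phi> \<theta>) = evolution_op N \<alpha> J h t0 dt nt" (is ?circuit)
proof -
  interpret diagonalizer "2 ^ N" "kron_pow (pauli_basis \<alpha>) N" "kron_pow (pauli_basis_inv \<alpha>) N"
    by (rule diagonalizer_kron_pow)
  have "\<exists>f. spin_op N \<alpha> i = diag_op f" if "i \<in> {1..N}" for i
    unfolding diag_op_def using spin_op_diagonalization[OF that] by metis
  \<comment> \<open>One eigenvalue function is chosen for each spin, all in the same basis.\<close>
  then obtain s where s: "\<And>i. i \<in> {1..N} \<Longrightarrow> spin_op N \<alpha> i = diag_op (s i)"
    by metis
  define E where "E g = diag_op (\<lambda>x. exp (g x))" for g
  \<comment> \<open>\<open>e1\<close> and \<open>e2\<close> are the exponents per unit angle: a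
    rotation by \<open>a\<close> is \<open>E\<close> of \<open>a\<close> times the corresponding
    function.\<close>
  define e1 where "e1 i x = - \<i> / 2 * s i x" for i x
  define e2 where "e2 i x = - \<i> / 2 * (s i x * s (i + 1) x)" for i x
  have E_mult: "E f * E g = E (\<lambda>x. f x + g x)" for f g
    by (simp add: E_def diag_op_mult exp_add)
  have E_prod: "mat_prod (2 ^ N) (map (\<lambda>i. E (f i)) xs) = E (\<lambda>x. \<Sum>i\<leftarrow>xs. f i x)"
    for f and xs :: "nat list"
    by (simp add: E_def mat_prod_exp_diag_op)
  have r1: "mat_prod (2 ^ N) (map (\<lambda>i. rot1 N \<alpha> i (a i)) xs) = E (\<lambda>x. \<Sum>i\<leftarrow>xs. a i * e1 i x)"
    if "set xs \<subseteq> {1..N}" for a xs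
  proof -
    have "map (\<lambda>i. rot1 N \<alpha> i (a i)) xs = map (\<lambda>i. E (\<lambda>x. a i * e1 i x)) xs"
      using that by (auto simp: rot1_def s diag_op_smult mat_exp_diag_op E_def e1_def mult_ac)
    then show ?thesis by (simp only: E_prod)
  qed
  have r2: "mat_prod (2 ^ N) (map (\<lambda>i. rot2 N \<alpha> i (a i)) xs) = E (\<lambda>x. \<Sum>i\<leftarrow>xs. a i * e2 i x)"
    if "set xs \<subseteq> {1..<N}" for a xs
  proof -
    have "map (\<lambda>i. rot2 N \<alpha> i (a i)) xs = map (\<lambda>i. E (\<lambda>x. a i * e2 i x)) xs"
      using that
      by (auto simp: rot2_def s diag_op_mult diag_op_smult mat_exp_diag_op E_def e2_def mult_ac
          dest!: subsetD)
    then show ?thesis by (simp only: E_prod)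
  qed
  \<comment> \<open>The general element with bond angles \<open>a\<close> and spin angles
    \<open>b\<close>. Both a single step and the whole evolution are shown to have this
    form.\<close>
  define G where "G a b = E (\<lambda>x. (\<Sum>i\<leftarrow>[1..<N]. complex_of_real (a i) * e2 i x)
      + (\<Sum>i\<leftarrow>[1..<N + 1]. complex_of_real (b i) * e1 i x))" for a b
  have step: "step_op N \<alpha> J h t0 dt \<tau>
      = G (\<lambda>i. 2 * J i (t \<tau>) * dt) (\<lambda>i. 2 * h i (t \<tau>) * dt)" for \<tau>
    unfolding step_op_def G_def t_def by (subst r1 r2; (subst r1 r2)?) (auto simp: E_mult)
  have H: "ising_hamiltonian N \<alpha> J h (t \<tau>)
      = diag_op (\<lambda>x. (\<Sum>i\<leftarrow>[1..<N]. J i (t \<tau>) * (s i x * s (i + 1) x))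
        + (\<Sum>i\<leftarrow>[1..<N + 1]. h i (t \<tau>) * s i x))"
  proof -
    have "map (\<lambda>i. complex_of_real (J i (t \<tau>)) \<cdot>\<^sub>m (spin_op N \<alpha> i * spin_op N \<alpha> (i + 1))) [1..<N]
        = map (\<lambda>i. diag_op (\<lambda>x. J i (t \<tau>) * (s i x * s (i + 1) x))) [1..<N]"
      by (auto simp: s diag_op_mult diag_op_smult)
    moreover have "map (\<lambda>i. complex_of_real (h i (t \<tau>)) \<cdot>\<^sub>m spin_op N \<alpha> i) [1..<N + 1]
        = map (\<lambda>i. diag_op (\<lambda>x. h i (t \<tau>) * s i x)) [1..<N + 1]"
      by (auto simp: s diag_op_smult)
    ultimately show ?thesis
      unfolding ising_hamiltonian_def by (simp only: mat_sum_diag_op diag_op_add)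
  qed
  \<comment> \<open>The factor 2 in the step angles cancels the 1/2 in \<open>e1\<close> and
    \<open>e2\<close>.\<close>
  show ?step
    unfolding step H G_def E_def diag_op_smult mat_exp_diag_op e1_def e2_def
    by (simp only: distrib_left sum_list_const_mult[symmetric])
      (simp add: mult_ac)
  have U: "evolution_op N \<alpha> J h t0 dt nt = G \<phi> \<theta>"
  proof -
    define e where "e k x = (\<Sum>i\<leftarrow>[1..<N]. complex_of_real (2 * J i (t k) * dt) * e2 i x)
      + (\<Sum>i\<leftarrow>[1..<N + 1]. complex_of_real (2 * h i (t k) * dt) * e1 i x)" for k x
    have "evolution_op N \<alpha> J h t0 dt nt = E (\<lambda>x. \<Sum>k\<leftarrow>[0..<nt]. e (nt - k) x)"
      unfolding evolution_op_def step G_def e_def[symmetric] by (rule E_prod)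
    also have "(\<lambda>x. \<Sum>k\<leftarrow>[0..<nt]. e (nt - k) x) = (\<lambda>x. \<Sum>k = 1..nt. e k x)"
    proof
      fix x
      have "(\<Sum>k\<leftarrow>[0..<nt]. e (nt - k) x) = (\<Sum>k = 0..<nt. e (nt - k) x)"
        by (simp add: interv_sum_list_conv_sum_set_nat)
      also have "\<dots> = (\<Sum>k = 1..nt. e k x)"
        \<comment> \<open>The time-ordered product runs from \<open>nt\<close> down to 1; in the
          exponent the order is immaterial, and \<open>k \<mapsto> nt - k\<close> reverses
          it.\<close>
        by (rule sum.reindex_bij_witness[where i = "\<lambda>k. nt - k" and j = "\<lambda>k. nt - k"]) auto
      finally show "(\<Sum>k\<leftarrow>[0..<nt]. e (nt - k) x) = (\<Sum>k = 1..nt. e k x)" .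
    qed
    also have "E \<dots> = G \<phi> \<theta>"
    proof -
      \<comment> \<open>Exchanging the sums over time and sites collects, at each site, the
        coefficient that is the compressed angle.\<close>
      have swap: "(\<Sum>k = 1..nt. \<Sum>i\<leftarrow>xs. complex_of_real (2 * f i (t k) * dt) * g i)
          = (\<Sum>i\<leftarrow>xs. complex_of_real (summed_angle f t0 dt nt i) * g i)" for f g xs
        by (induction xs)
          (simp_all add: sum.distrib summed_angle_def t_def sum_distrib_right)
      show ?thesis
        by (simp only: G_def e_def \<phi>_def \<theta>_def sum.distrib swap[of J] swap[of h])
    qed
    finally show ?thesis .
  qed
  have odd: "mat_prod (2 ^ N) (map (\<lambda>i. rot2 N \<alpha> i (\<phi> i)) (filter odd [1..<N]))
      = E (\<lambda>x. \<Sum>i\<leftarrow>filter odd [1..<N]. \<phi> i * e2 i x)"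
    and even: "mat_prod (2 ^ N) (map (\<lambda>i. rot2 N \<alpha> i (\<phi> i)) (filter even [1..<N]))
      = E (\<lambda>x. \<Sum>i\<leftarrow>filter even [1..<N]. \<phi> i * e2 i x)"
    by (rule r2; auto)+
  have all: "mat_prod (2 ^ N) (map (\<lambda>i. rot1 N \<alpha> i (\<theta> i)) [1..<N + 1])
      = E (\<lambda>x. \<Sum>i\<leftarrow>[1..<N + 1]. \<theta> i * e1 i x)"
    by (rule r1) auto
  \<comment> \<open>Adding the exponents of the odd and even layers restores the sum over all
    bonds.\<close>
  show ?compressed
    unfolding U odd even all E_mult sum_list_filter_odd_even G_def ..
  \<comment> \<open>Unfolding \<open>mat_prod\<close> over the three layers nests them to the right
    and leaves a trailing identity, which is treated below as \<open>E\<close> of the zero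
    exponent.\<close>
  have C: "circuit_op N (compressed_circuit N \<alpha> \<phi> \<theta>)
      = mat_prod (2 ^ N) (map (\<lambda>i. rot2 N \<alpha> i (\<phi> i)) (filter odd [1..<N]))
        * (mat_prod (2 ^ N) (map (\<lambda>i. rot2 N \<alpha> i (\<phi> i)) (filter even [1..<N]))
        * (mat_prod (2 ^ N) (map (\<lambda>i. rot1 N \<alpha> i (\<theta> i)) [1..<N + 1]) * 1\<^sub>m (2 ^ N)))"
    by (simp add: circuit_op_def compressed_circuit_def mat_prod_def comp_def del: upt_Suc)
  have one: "1\<^sub>m (2 ^ N) = E (\<lambda>x. 0)"
    by (simp add: E_def diag_op_one)
  show ?circuit
    unfolding C odd even all one E_mult U G_def
    by (simp only: add_0_right add.assoc[symmetric] sum_list_filter_odd_even)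
qed

theorem mainTheorem2:
  shows
    "(\<forall>(N::nat) (nt::nat) (\<alpha>::axis) (J::nat \<Rightarrow> real \<Rightarrow> real) (h::nat \<Rightarrow> real \<Rightarrow> real) (t0::real) (dt::real).
        N \<ge> 2 \<longrightarrow> nt \<ge> 1 \<longrightarrow> dt > 0 \<longrightarrow>
        (let \<phi> = summed_angle J t0 dt nt;
             \<theta> = summed_angle h t0 dt nt;
             U = evolution_op N \<alpha> J h t0 dt nt;
             c = compressed_circuit N \<alpha> \<phi> \<theta>
         in
           (\<forall>\<tau>. step_op N \<alpha> J h t0 dt \<tau>
                 = mat_exp ((- \<i> * complex_of_real dt)
                     \<cdot>\<^sub>m ising_hamiltonian N \<alpha> J h (time_point t0 dt \<tau>))) \<and>
           U = mat_prod (2 ^ N) (map (\<lambda>i. rot2 N \<alpha> i (\<phi> i)) (filter odd [1..<N]))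
             * mat_prod (2 ^ N) (map (\<lambda>i. rot2 N \<alpha> i (\<phi> i)) (filter even [1..<N]))
             * mat_prod (2 ^ N) (map (\<lambda>i. rot1 N \<alpha> i (\<theta> i)) [1..<N + 1]) \<and>
           is_circuit N c \<and> circuit_op N c = U \<and> circuit_depth c = 3))
     \<and> (\<exists>C::nat. \<forall>(N::nat) (nt::nat). N \<ge> 2 \<longrightarrow> nt \<ge> 1 \<longrightarrow>
          (\<exists>P. computes_angles N nt P \<and> length P \<le> C * (nt * N)))"
proof -
  \<comment> \<open>The witnesses are \<open>C = 8\<close> and
    \<open>angle_program N nt\<close>.\<close>
  have "\<exists>C::nat. \<forall>N nt. N \<ge> 2 \<longrightarrow> nt \<ge> 1 \<longrightarrow>
      (\<exists>P. computes_angles N nt P \<and> length P \<le> C * (nt * N))"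
    using angle_program_computes_angles length_angle_program_le by blast
  then show ?thesis
    unfolding Let_def
    by (intro conjI allI impI compressed_evolution is_circuit_compressed)
      (simp add: circuit_depth_def compressed_circuit_def)
qed

end
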